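(* Let $\Lambda_0>0$, $\alpha\in(0,1)$, $\gamma>0$. Let $\lambda$ be the expected intensity of the fractional Hawkes process with $\beta=1/2$ and these parameters, i.e. the function on $[0,\infty)$ with Laplace transform $$\tilde\lambda(s)=\frac{\Lambda_0}{s}\,\frac{\gamma+s^{1/2}}{(1-\alpha)\gamma+s^{1/2}},$$ and let $\mathbb{E}[N(t)]=\int_0^t\lambda(u)\,du$ be the expected number of events up to time $t$. Then, for all $t\ge0$, $$\mathbb{E}[N(t)]=\frac{\Lambda_0}{1-\alpha}\,t-\frac{\alpha\Lambda_0}{(1-\alpha)^3\gamma^2\sqrt{\pi}}\left(\sqrt{\pi}\,e^{(1-\alpha)^2\gamma^2t}\operatorname{erfc}\big((1-\alpha)\gamma\sqrt{t}\big)+2(1-\alpha)\gamma\sqrt{t}-\sqrt{\pi}\right).$$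
   Context: The Laplace transform of a function $f$ on $[0,\infty)$ is $\int_0^\infty e^{-st}f(t)\,dt$; $\lambda$ is the continuous function on $[0,\infty)$ whose Laplace transform equals $\tilde\lambda(s)$ for all sufficiently large real $s$. The number of events up to time $t$ of the fractional Hawkes process is denoted $N(t)$; its expectation is the integral of the expected intensity, $\mathbb{E}[N(t)]=\int_0^t\lambda(u)\,du$. The complementary error function is $\operatorname{erfc}(t)=\frac{2}{\sqrt{\pi}}\int_t^\infty e^{-\tau^2}\,d\tau$. *)

theory Defs
  imports "HOL-Analysis.Analysis"
begin

(* The Henstock-Kurzweil integral over {0..} also covers conditionally convergent
   improper integrals, so no absolute integrability is imposed on f. *)
definition has_laplace :: "(real \<Rightarrow> real) \<Rightarrow> real \<Rightarrow> real \<Rightarrow> bool" where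
  "has_laplace f F s \<longleftrightarrow> ((\<lambda>t. exp (- s * t) * f t) has_integral F) {0..}"

definition hawkes_laplace :: "real \<Rightarrow> real \<Rightarrow> real \<Rightarrow> real \<Rightarrow> real" where
  "hawkes_laplace \<Lambda>\<^sub>0 \<alpha> \<gamma> s =
     \<Lambda>\<^sub>0 / s * ((\<gamma> + s powr (1/2)) / ((1 - \<alpha>) * \<gamma> + s powr (1/2)))"

(* Functions on [0,\<infinity>) are represented by total functions whose values on
   negative arguments are irrelevant; beta = 1/2 throughout. *)
definition hawkes_expected_intensity ::
    "real \<Rightarrow> real \<Rightarrow> real \<Rightarrow> (real \<Rightarrow> real) \<Rightarrow> bool" where
  "hawkes_expected_intensity \<Lambda>\<^sub>0 \<alpha> \<gamma> lam \<longleftrightarrow>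
     continuous_on {0..} lam \<and>
     (\<forall>\<^sub>F s in at_top. has_laplace lam (hawkes_laplace \<Lambda>\<^sub>0 \<alpha> \<gamma> s) s)"

definition expected_events :: "(real \<Rightarrow> real) \<Rightarrow> real \<Rightarrow> real" where
  "expected_events lam t = integral {0..t} lam"

definition erfc :: "real \<Rightarrow> real" where
  "erfc t = 2 / sqrt pi * integral {t..} (\<lambda>\<tau>. exp (- (\<tau>\<^sup>2)))"

end

(* Put c = (1 - alpha) gamma and E(t) = exp (c^2 t) erfc (c sqrt t). Since
   E' = c^2 E - c / sqrt (pi t), both E and exp (-s t) E(t) have antiderivatives built from E,
   sqrt and erfc. The second one gives the Laplace transform 1 / (sqrt s (sqrt s + c)) of E, so
   that (Lambda0 / (1 - alpha)) (1 - alpha E) has the prescribed transform. By Lerch's uniqueness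
   theorem this function is the intensity, and the first antiderivative yields its integral. *)
theory Submission
  imports Defs "HOL-Probability.Distributions" "HOL-Real_Asymp.Real_Asymp"
begin

section \<open>Integrals over half-lines and the fundamental theorem of calculus\<close>

text \<open>Every sufficiently large symmetric box meets the half-line in some
  \<open>{a..T}\<close>. Hence a Laplace transform given as a possibly conditional integral becomes
  a limit of proper integrals, the form used in the uniqueness argument.\<close>

lemma has_integral_atLeast_imp_tendsto:
  fixes f :: "real \<Rightarrow> real"
  assumes "(f has_integral I) {a..}"
  shows "((\<lambda>T. integral {a..T} f) \<longlongrightarrow> I) at_top"
proof (rule tendstoI)
  fix e :: real assume "e > 0"
  then obtain B where B: "B > 0" "\<And>u v. ball 0 B \<subseteq> cbox u v \<Longrightarrow>
      norm (integral (cbox u v) (\<lambda>x. if x \<in> {a..} then f x else 0) - I) < e"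
    using assms unfolding has_integral_alt' by metis
  \<comment> \<open>\<open>T\<close> at least \<open>B\<close> makes the box contain the ball;
    \<open>T\<close> at least the absolute value of \<open>a\<close> gives \<open>-T\<close> \<le>
    \<open>a\<close>, so the box cuts the half-line exactly at \<open>T\<close>.\<close>
  have "dist (integral {a..T} f) I < e" if T: "T \<ge> max B \<bar>a\<bar>" for T
  proof -
    have "ball 0 B \<subseteq> cbox (- T) T"
      using T by (auto simp: dist_real_def)
    then have "norm (integral (cbox (- T) T) (\<lambda>x. if x \<in> {a..} then f x else 0) - I) < e"
      by (rule B)
    moreover have "integral (cbox (- T) T) (\<lambda>x. if x \<in> {a..} then f x else 0) =
        integral ({a..} \<inter> cbox (- T) T) f"
      by (rule integral_restrict_Int)
    moreover have "{a..} \<inter> cbox (- T) T = {a..T}"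
      using T by auto
    ultimately show ?thesis
      by (simp only: dist_norm)
  qed
  then show "\<forall>\<^sub>F T in at_top. dist (integral {a..T} f) I < e"
    unfolding eventually_at_top_linorder by blast
qed

lemma integral_has_real_derivative_atLeast:
  fixes k :: "real \<Rightarrow> real"
  assumes "continuous_on {a..} k" "a \<le> t"
  shows "((\<lambda>x. integral {a..x} k) has_real_derivative k t) (at t within {a..})"
proof -
  \<comment> \<open>The endpoint \<open>t + 1\<close> lies strictly beyond \<open>t\<close>, so near
    \<open>t\<close> the compact interval and the half-line agree.\<close>
  have "((\<lambda>x. integral {a..x} k) has_real_derivative k t) (at t within {a..t + 1})"
    using assms by (intro integral_has_real_derivative) (auto elim: continuous_on_subset)
  also have "at t within {a..t + 1} = at t within {a..}"
    by (rule at_within_nhd[of t "{..<t + 1}"]) auto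
  finally show ?thesis .
qed

text \<open>Asking for derivatives only in the open interval admits antiderivatives containing
  \<open>sqrt\<close>, which are continuous but not differentiable at 0.\<close>

lemma has_integral_FTC_real:
  fixes F :: "real \<Rightarrow> real"
  assumes "a \<le> b" "continuous_on {a..b} F"
    and "\<And>x. a < x \<Longrightarrow> x < b \<Longrightarrow> (F has_real_derivative f x) (at x)"
  shows "(f has_integral (F b - F a)) {a..b}"
  using assms by (intro fundamental_theorem_of_calculus_interior)
    (auto simp: has_real_derivative_iff_has_vector_derivative)

section \<open>Lerch's uniqueness theorem\<close>

text \<open>
  In the variable x = exp (-t) the hypotheses say that all moments of a continuous function on
  [0,1] vanish; by Weierstrass, so does the integral of exp (-t) times the square of h.
\<close>

lemma vanishing_moments_imp_zero:
  fixes h :: "real \<Rightarrow> real"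
  assumes cont: "continuous_on {0..} h" and lim: "(h \<longlongrightarrow> 0) at_top"
    and mom: "\<And>n. (1::nat) \<le> n \<Longrightarrow> ((\<lambda>T. integral {0..T} (\<lambda>t. exp (- n * t) * h t)) \<longlongrightarrow> 0) at_top"
    and "t \<ge> 0"
  shows "h t = 0"
proof -
  have cont': "continuous_on {0..T} h" for T
    by (rule continuous_on_subset[OF cont]) auto
  \<comment> \<open>The value at 0 is the limit of \<open>h\<close> at infinity, which makes
    \<open>H\<close> continuous on the closed interval.\<close>
  define H where "H x = (if x = 0 then 0 else h (- ln x))" for x
  have H_exp: "H (exp (- x)) = h x" for x
    by (simp add: H_def)
  have "continuous_on {0..1} H"
    unfolding continuous_on_eq_continuous_within
  proof
    fix x :: real assume x: "x \<in> {0..1}"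
    show "continuous (at x within {0..1}) H"
    proof (cases "x = 0")
      case True
      have "filterlim (\<lambda>x. - ln x) at_top (at_right (0::real))"
        using ln_at_0 by (simp add: filterlim_uminus_at_bot)
      then have "((\<lambda>x. h (- ln x)) \<longlongrightarrow> 0) (at_right 0)"
        by (rule filterlim_compose[OF lim])
      then have "(H \<longlongrightarrow> 0) (at_right 0)"
        by (rule Lim_transform_eventually)
          (auto simp: H_def eventually_at_topological intro!: exI[of _ UNIV])
      moreover have "at (0::real) within {0..1} = at_right 0"
        by (simp add: at_within_Icc_at_right)
      ultimately show ?thesis
        using True by (simp add: continuous_within H_def)
    next
      case False
      have "continuous_on {0<..1} (\<lambda>x::real. h (- ln x))"
        by (rule continuous_on_compose2[OF cont]) (auto intro!: continuous_intros)
      then have "continuous_on {0<..1} H"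
        by (rule continuous_on_eq) (auto simp: H_def)
      then have "continuous (at x within {0<..1}) H"
        using x False by (auto simp: continuous_on_eq_continuous_within)
      also have "at x within {0<..1} = at x within {0..1}"
        by (rule at_within_nhd[of x "{0<..}"]) (use x False in auto)
      finally show ?thesis .
    qed
  qed
  then have "bounded (H ` {0..1})"
    by (intro compact_imp_bounded compact_continuous_image) auto
  then obtain M where M: "M > 0" "\<And>x. x \<in> {0..1} \<Longrightarrow> \<bar>H x\<bar> \<le> M"
    by (auto simp: bounded_pos)
  have h_le: "\<bar>h x\<bar> \<le> M" if "x \<ge> 0" for x
    using M(2)[of "exp (- x)"] that by (simp add: H_exp)
  define q where "q T = integral {0..T} (\<lambda>t. exp (- t) * (h t)\<^sup>2)" for T
  have q_int: "(\<lambda>t. exp (- t) * (h t)\<^sup>2) integrable_on {0..T}" for T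
    by (intro integrable_continuous_real continuous_intros cont')
  \<comment> \<open>\<open>q\<close> is nondecreasing on nonnegative arguments, so
    \<open>q T\<^sub>0\<close> is compared with \<open>q T\<close> for large \<open>T\<close>; there
    a polynomial in exp(-t) replaces one factor \<open>h\<close>, and its contribution
    \<open>P T\<close> tends to 0.\<close>
  have q_nonpos: "q T\<^sub>0 \<le> 0" for T\<^sub>0
  proof (rule field_le_epsilon)
    fix e :: real assume "e > 0"
    with M have "e / M > 0" by simp
    \<comment> \<open>Accuracy \<open>e / M\<close> compensates the bound \<open>M\<close> on the
      other factor \<open>h\<close>: the product is at most \<open>e\<close>, and the weight exp(-t)
      has total mass at most 1.\<close>
    with \<open>continuous_on {0..1} H\<close> obtain p
      where p: "real_polynomial_function p" "\<And>x. x \<in> {0..1} \<Longrightarrow> \<bar>H x - p x\<bar> < e / M"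
      using Stone_Weierstrass_real_polynomial_function[of "{0..1::real}" H "e / M"] by auto
    from p(1) obtain a m where p_eq: "p = (\<lambda>x. \<Sum>i\<le>m. a i * x ^ i)"
      unfolding real_polynomial_function_iff_sum by blast
    define P where "P T = integral {0..T} (\<lambda>t. exp (- t) * p (exp (- t)) * h t)" for T
    have P_int: "(\<lambda>t. exp (- t) * p (exp (- t)) * h t) integrable_on {0..T}" for T
      unfolding p_eq by (intro integrable_continuous_real continuous_intros cont')
    \<comment> \<open>The weight exp(-t) raises each exponent by one, so the monomial of degree
      \<open>i\<close> yields the moment of order \<open>Suc i\<close>, and order 0 never
      occurs.\<close>
    have "P = (\<lambda>T. \<Sum>i\<le>m. a i * integral {0..T} (\<lambda>t. exp (- real (Suc i) * t) * h t))"
    proof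
      fix T
      have "exp (- t) * p (exp (- t)) * h t = (\<Sum>i\<le>m. a i * (exp (- real (Suc i) * t) * h t))" for t
        by (simp add: p_eq sum_distrib_left sum_distrib_right exp_of_nat_mult[symmetric]
            algebra_simps exp_add exp_diff exp_minus divide_simps)
      then show "P T = (\<Sum>i\<le>m. a i * integral {0..T} (\<lambda>t. exp (- real (Suc i) * t) * h t))"
        unfolding P_def
        by (simp, subst integral_sum)
          (auto intro!: integrable_continuous_real continuous_intros cont')
    qed
    moreover have "((\<lambda>T. \<Sum>i\<le>m. a i * integral {0..T} (\<lambda>t. exp (- real (Suc i) * t) * h t))
        \<longlongrightarrow> (\<Sum>i\<le>m. a i * 0)) at_top"
      by (intro tendsto_intros mom) auto
    ultimately have "(P \<longlongrightarrow> 0) at_top"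
      by (simp only: mult_zero_right sum.neutral_const)
    then have "((\<lambda>T. P T + e) \<longlongrightarrow> 0 + e) at_top"
      by (intro tendsto_intros)
    moreover have "q T\<^sub>0 \<le> P T + e" if T: "T \<ge> max 0 T\<^sub>0" for T
    proof -
      have "q T\<^sub>0 \<le> q T"
        unfolding q_def by (rule integral_subset_le) (use T q_int in auto)
      also have "q T - P T = integral {0..T} (\<lambda>t. exp (- t) * (h t)\<^sup>2 - exp (- t) * p (exp (- t)) * h t)"
        unfolding q_def P_def by (rule integral_diff[symmetric]) (fact q_int P_int)+
      also have "\<dots> \<le> integral {0..T} (\<lambda>t. e * exp (- t))"
      proof (rule integral_le)
        fix t assume t: "t \<in> {0..T}"
        have "\<bar>h t * (h t - p (exp (- t)))\<bar> \<le> M * (e / M)"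
          unfolding abs_mult
          using t h_le[of t] p(2)[of "exp (- t)"] M(1)
          by (intro mult_mono) (auto simp: H_exp)
        then have "h t * (h t - p (exp (- t))) \<le> e"
          using M(1) by simp
        then have "exp (- t) * (h t * (h t - p (exp (- t)))) \<le> exp (- t) * e"
          by (intro mult_left_mono) auto
        then show "exp (- t) * (h t)\<^sup>2 - exp (- t) * p (exp (- t)) * h t \<le> e * exp (- t)"
          by (simp add: algebra_simps power2_eq_square)
      qed (rule integrable_diff[OF q_int P_int], intro integrable_continuous_real continuous_intros)
      also have "\<dots> = e * (1 - exp (- T))"
      proof -
        have "((\<lambda>t. e * exp (- t)) has_integral (- e * exp (- T) - (- e * exp (- 0)))) {0..T}"
          by (rule has_integral_FTC_real) (use T in \<open>auto intro!: continuous_intros derivative_eq_intros\<close>)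
        then show ?thesis
          by (intro integral_unique) (simp add: right_diff_distrib)
      qed
      also have "\<dots> \<le> e"
        using \<open>e > 0\<close> by (simp add: algebra_simps)
      finally show ?thesis by simp
    qed
    then have "\<forall>\<^sub>F T in at_top. q T\<^sub>0 \<le> P T + e"
      unfolding eventually_at_top_linorder by blast
    ultimately show "q T\<^sub>0 \<le> 0 + e"
      by (intro tendsto_lowerbound[of "\<lambda>T. P T + e" "0 + e" at_top]) auto
  qed
  \<comment> \<open>A nonnegative continuous integrand with integral 0 vanishes. Integrating up to
    \<open>t + 1\<close> keeps the interval nondegenerate when \<open>t\<close> is 0.\<close>
  have "q (t + 1) \<ge> 0"
    unfolding q_def by (intro integral_nonneg q_int) auto
  with q_nonpos[of "t + 1"] have "integral {0..t + 1} (\<lambda>t. exp (- t) * (h t)\<^sup>2) = 0"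
    by (simp add: q_def)
  then have "\<forall>x\<in>{0..t + 1}. exp (- x) * (h x)\<^sup>2 = 0"
    using \<open>t \<ge> 0\<close> by (subst (asm) integral_eq_0_iff) (auto intro!: continuous_intros cont')
  with \<open>t \<ge> 0\<close> show ?thesis
    by auto
qed

text \<open>
  The function g may grow fast and its Laplace integral may converge only conditionally.
  Integration by parts replaces g by the primitive of exp (-s t) g(t), which is continuous and
  tends to 0.
\<close>

lemma Lerch_zero:
  fixes g :: "real \<Rightarrow> real"
  assumes cont: "continuous_on {0..} g"
    and lim: "\<And>n::nat. ((\<lambda>T. integral {0..T} (\<lambda>t. exp (- (s + n) * t) * g t)) \<longlongrightarrow> 0) at_top"
    and "t \<ge> 0"
  shows "g t = 0"
proof -
  define k where "k t = exp (- s * t) * g t" for t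
  define h where "h T = integral {0..T} k" for T
  have cont_k: "continuous_on {0..} k"
    unfolding k_def by (intro continuous_intros cont)
  have deriv_h: "(h has_real_derivative k x) (at x within {0..})" if "x \<ge> 0" for x
    unfolding h_def using cont_k that by (rule integral_has_real_derivative_atLeast)
  have cont_h: "continuous_on {0..} h"
    by (rule DERIV_continuous_on[of _ _ k]) (use deriv_h in auto)
  have k_lim: "((\<lambda>T. integral {0..T} (\<lambda>t. exp (- real n * t) * k t)) \<longlongrightarrow> 0) at_top" for n
    using lim[of n] by (simp add: k_def mult_exp_exp algebra_simps)
  \<comment> \<open>The case \<open>n = 0\<close> of the hypothesis, in which \<open>k\<close> is
    integrated without a further exponential factor.\<close>
  have h_lim: "(h \<longlongrightarrow> 0) at_top"
    using k_lim[of 0] by (simp add: h_def[abs_def])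
  have h0: "h 0 = 0" by (simp add: h_def)
  have "h x = 0" if "x \<ge> 0" for x
  proof (rule vanishing_moments_imp_zero[OF cont_h h_lim _ that])
    fix n :: nat assume n: "n \<ge> 1"
    let ?E = "\<lambda>t. exp (- real n * t)"
    \<comment> \<open>Integration by parts; the boundary term at 0 drops out because
      \<open>h 0 = 0\<close>, and \<open>n\<close> \<ge> 1 permits the division.\<close>
    have eq: "integral {0..T} (\<lambda>t. ?E t * h t) = (integral {0..T} (\<lambda>t. ?E t * k t) - ?E T * h T) / n"
      if "T \<ge> 0" for T
    proof -
      have "((\<lambda>t. ?E t * k t - n * (?E t * h t)) has_integral (?E T * h T - ?E 0 * h 0)) {0..T}"
      proof (rule has_integral_FTC_real[OF that])
        fix x assume "0 < x" "x < T"
        then have "(h has_real_derivative k x) (at x)"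
          using deriv_h[of x] at_within_interior[of x "{0..}"] by simp
        then show "((\<lambda>t. ?E t * h t) has_real_derivative ?E x * k x - n * (?E x * h x)) (at x)"
          by (auto intro!: derivative_eq_intros)
      qed (auto intro!: continuous_intros continuous_on_subset[OF cont_h])
      then have "integral {0..T} (\<lambda>t. ?E t * k t - n * (?E t * h t)) = ?E T * h T"
        by (simp add: integral_unique h0)
      moreover have "integral {0..T} (\<lambda>t. ?E t * k t - n * (?E t * h t)) =
          integral {0..T} (\<lambda>t. ?E t * k t) - integral {0..T} (\<lambda>t. n * (?E t * h t))"
        by (intro integral_diff integrable_continuous_real continuous_intros
            continuous_on_subset[OF cont_h] continuous_on_subset[OF cont_k]) auto
      ultimately show ?thesis
        using n by (simp add: field_simps)
    qed
    have "(?E \<longlongrightarrow> 0) at_top"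
      using n by real_asymp
    then have "((\<lambda>T. (integral {0..T} (\<lambda>t. ?E t * k t) - ?E T * h T) / n) \<longlongrightarrow> (0 - 0 * 0) / n) at_top"
      using n by (intro tendsto_intros k_lim h_lim) auto
    then have "((\<lambda>T. (integral {0..T} (\<lambda>t. ?E t * k t) - ?E T * h T) / n) \<longlongrightarrow> 0) at_top"
      by simp
    then show "((\<lambda>T. integral {0..T} (\<lambda>t. ?E t * h t)) \<longlongrightarrow> 0) at_top"
      by (rule Lim_transform_eventually[OF _ eventually_mono[OF eventually_ge_at_top[of 0]]])
        (simp only: eq)
  qed
  \<comment> \<open>Since \<open>h\<close> is identically 0 on the half-line, its derivative
    \<open>k\<close> must vanish there. Uniqueness of a one-sided derivative suffices, which also
    covers \<open>t = 0\<close>.\<close>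
  then have "((\<lambda>x. 0) has_real_derivative k t) (at t within {0..})"
    using \<open>t \<ge> 0\<close>
    by (intro has_field_derivative_transform_within[OF deriv_h, of t 1]) auto
  then have "((\<lambda>x. 0) has_real_derivative k t) (at t within {t..t+1})"
    by (rule DERIV_subset) (use \<open>t \<ge> 0\<close> in auto)
  moreover have "((\<lambda>x. 0) has_real_derivative 0) (at t within {t..t+1})"
    by simp
  ultimately have "k t = 0"
    by (rule has_field_derivative_unique) (auto simp: trivial_limit_within islimpt_Icc)
  then show ?thesis
    by (simp add: k_def)
qed

section \<open>The complementary error function\<close>

lemma gaussian_has_integral_atLeast_0:
  "((\<lambda>x::real. exp (- (x\<^sup>2))) has_integral (sqrt pi / 2)) {0..}"
proof -
  have "set_integrable lborel {0..} (\<lambda>x::real. exp (- (x\<^sup>2)))"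
    "(LINT x : {0..} | lborel. exp (- (x\<^sup>2))) = sqrt pi / 2"
    using gaussian_moment_0
    by (auto simp: set_integrable_def set_lebesgue_integral_def has_bochner_integral_iff)
  with set_borel_integral_eq_integral[of "{0..}" "\<lambda>x::real. exp (- (x\<^sup>2))"]
  show ?thesis
    by (metis integrable_integral)
qed

text \<open>Subtracting from the full half-line Gaussian integral turns the tail into a proper
  integral with variable upper endpoint, from which derivative, continuity and limit can be read
  off.\<close>

lemma erfc_eq:
  assumes "x \<ge> 0"
  shows "erfc x = 1 - 2 / sqrt pi * integral {0..x} (\<lambda>\<tau>. exp (- (\<tau>\<^sup>2)))"
proof -
  let ?g = "\<lambda>\<tau>::real. exp (- (\<tau>\<^sup>2))"
  have "(?g has_integral integral {0..x} ?g) {0..x}"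
    by (intro integrable_integral integrable_continuous_real continuous_intros)
  moreover have "negligible ({0..x} - {0..})"
    by simp
  ultimately have "(?g has_integral (sqrt pi / 2 - integral {0..x} ?g)) ({0..} - {0..x})"
    by (intro has_integral_setdiff gaussian_has_integral_atLeast_0)
  moreover have "{0..} - {0..x} = {x<..}"
    using assms by auto
  \<comment> \<open>The two rays differ only in the point \<open>x\<close>.\<close>
  moreover have "(?g has_integral I) {x<..} \<longleftrightarrow> (?g has_integral I) {x..}" for I
    by (rule has_integral_spike_set_eq) (rule negligible_subset[OF negligible_sing[of x]], force)+
  ultimately have "(?g has_integral (sqrt pi / 2 - integral {0..x} ?g)) {x..}"
    by (simp only:)
  then have "integral {x..} ?g = sqrt pi / 2 - integral {0..x} ?g"
    by (rule integral_unique)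
  then show ?thesis
    by (simp add: erfc_def right_diff_distrib)
qed

lemma erfc_0: "erfc 0 = 1"
  by (simp add: erfc_eq)

lemma erfc_has_real_derivative:
  assumes "x \<ge> 0"
  shows "(erfc has_real_derivative - (2 / sqrt pi * exp (- (x\<^sup>2)))) (at x within {0..})"
proof -
  have "((\<lambda>x. 1 - 2 / sqrt pi * integral {0..x} (\<lambda>\<tau>. exp (- (\<tau>\<^sup>2)))) has_real_derivative
      0 - 2 / sqrt pi * exp (- (x\<^sup>2))) (at x within {0..})"
    using assms
    by (intro DERIV_diff[OF DERIV_const DERIV_cmult] integral_has_real_derivative_atLeast)
      (auto intro!: continuous_intros)
  then have "((\<lambda>x. 1 - 2 / sqrt pi * integral {0..x} (\<lambda>\<tau>. exp (- (\<tau>\<^sup>2)))) has_real_derivative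
      - (2 / sqrt pi * exp (- (x\<^sup>2)))) (at x within {0..})"
    by (simp only: diff_0)
  then show ?thesis
    by (rule has_field_derivative_transform_within[OF _ zero_less_one])
      (use assms in \<open>auto simp: erfc_eq\<close>)
qed

lemma erfc_has_real_derivative_at:
  assumes "x > 0"
  shows "(erfc has_real_derivative - (2 / sqrt pi * exp (- (x\<^sup>2)))) (at x)"
  using erfc_has_real_derivative[of x] at_within_interior[of x "{0..}"] assms by simp

lemma continuous_on_erfc: "continuous_on {0..} erfc"
  by (rule DERIV_continuous_on) (auto intro: erfc_has_real_derivative)

lemma erfc_tendsto_0: "(erfc \<longlongrightarrow> 0) at_top"
proof -
  have "((\<lambda>x. 1 - 2 / sqrt pi * integral {0..x} (\<lambda>\<tau>. exp (- (\<tau>\<^sup>2)))) \<longlongrightarrow>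
      1 - 2 / sqrt pi * (sqrt pi / 2)) at_top"
    by (intro tendsto_intros has_integral_atLeast_imp_tendsto gaussian_has_integral_atLeast_0)
  then have "((\<lambda>x. 1 - 2 / sqrt pi * integral {0..x} (\<lambda>\<tau>. exp (- (\<tau>\<^sup>2)))) \<longlongrightarrow> 0) at_top"
    by simp
  then show ?thesis
    by (rule Lim_transform_eventually[OF _ eventually_mono[OF eventually_ge_at_top[of 0]]])
      (simp only: erfc_eq)
qed

section \<open>The function exp(c^2 t) erfc(c sqrt t), its integral and its Laplace
  transform\<close>

text \<open>For \<open>c\<close> \<ge> 0 and \<open>t\<close> \<ge> 0 this is the Mittag-Leffler
  function of order 1/2 evaluated at -c sqrt t.\<close>

definition exp_erfc :: "real \<Rightarrow> real \<Rightarrow> real" where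
  "exp_erfc c t = exp (c\<^sup>2 * t) * erfc (c * sqrt t)"

lemma exp_erfc_0: "exp_erfc c 0 = 1"
  by (simp add: exp_erfc_def erfc_0)

lemma continuous_on_erfc_sqrt: "c \<ge> 0 \<Longrightarrow> continuous_on {0..} (\<lambda>t. erfc (c * sqrt t))"
  by (rule continuous_on_compose2[OF continuous_on_erfc]) (auto intro!: continuous_intros)

lemma continuous_on_exp_erfc: "c \<ge> 0 \<Longrightarrow> continuous_on {0..} (exp_erfc c)"
  unfolding exp_erfc_def by (intro continuous_intros continuous_on_erfc_sqrt)

lemma erfc_sqrt_has_real_derivative:
  assumes "c > 0" "t > 0"
  shows "((\<lambda>t. erfc (c * sqrt t)) has_real_derivative
      - (c / (sqrt pi * sqrt t) * exp (- (c\<^sup>2 * t)))) (at t)"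
proof -
  have "((\<lambda>t. erfc (c * sqrt t)) has_real_derivative
      - (2 / sqrt pi * exp (- ((c * sqrt t)\<^sup>2))) * (c * (inverse (sqrt t) / 2))) (at t)"
    by (rule DERIV_chain2[OF erfc_has_real_derivative_at])
      (use assms in \<open>auto intro!: derivative_eq_intros\<close>)
  moreover have "2 / p * e * (c * (inverse r / 2)) = c / (p * r) * e" for p r e :: real
    by (cases "p = 0"; cases "r = 0") (simp_all add: field_simps)
  ultimately show ?thesis
    using assms by (simp only: power_mult_distrib real_sqrt_pow2 less_imp_le mult_minus_left)
qed

text \<open>The Gaussian factor from differentiating \<open>erfc\<close> cancels against exp(c^2 t),
  leaving a linear differential equation for \<open>exp_erfc c\<close> with an elementary forcing
  term.\<close>

lemma exp_erfc_has_real_derivative: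
  assumes "c > 0" "t > 0"
  shows "(exp_erfc c has_real_derivative
      c\<^sup>2 * exp_erfc c t - c / (sqrt pi * sqrt t)) (at t)"
proof -
  have "((\<lambda>t. exp (c\<^sup>2 * t) * erfc (c * sqrt t)) has_real_derivative
      (exp (c\<^sup>2 * t) * c\<^sup>2) * erfc (c * sqrt t) +
      (- (c / (sqrt pi * sqrt t) * exp (- (c\<^sup>2 * t)))) * exp (c\<^sup>2 * t)) (at t)"
    by (rule DERIV_mult[OF _ erfc_sqrt_has_real_derivative])
      (use assms in \<open>auto intro!: derivative_eq_intros\<close>)
  moreover have "exp (- (c\<^sup>2 * t)) * exp (c\<^sup>2 * t) = 1"
    by (simp add: mult_exp_exp)
  ultimately show ?thesis
    by (simp add: exp_erfc_def[abs_def] mult.assoc mult.left_commute)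
qed

text \<open>Solving the differential equation for the function itself and integrating gives the
  antiderivative; the square root comes from the forcing term.\<close>

lemma exp_erfc_has_integral:
  assumes "c > 0" "t \<ge> 0"
  shows "(exp_erfc c has_integral ((exp_erfc c t - 1) / c\<^sup>2 + 2 * sqrt t / (c * sqrt pi))) {0..t}"
proof -
  let ?F = "\<lambda>t. exp_erfc c t / c\<^sup>2 + 2 * sqrt t / (c * sqrt pi)"
  have "(exp_erfc c has_integral (?F t - ?F 0)) {0..t}"
  proof (rule has_integral_FTC_real[OF \<open>t \<ge> 0\<close>])
    show "continuous_on {0..t} ?F"
      using assms by (intro continuous_intros continuous_on_subset[OF continuous_on_exp_erfc]) auto
    fix x assume "0 < x" "x < t"
    then show "(?F has_real_derivative exp_erfc c x) (at x)"
      using assms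
      by (auto intro!: derivative_eq_intros exp_erfc_has_real_derivative simp: field_simps power2_eq_square)
  qed
  then show ?thesis
    by (simp add: exp_erfc_0 diff_divide_distrib algebra_simps)
qed

lemma exp_erfc_laplace:
  assumes c: "c > 0" and s: "s > c\<^sup>2"
  shows "((\<lambda>T. integral {0..T} (\<lambda>t. exp (- s * t) * exp_erfc c t)) \<longlongrightarrow>
    1 / (sqrt s * (sqrt s + c))) at_top"
proof -
  have "s > 0"
    using s zero_le_power2[of c] by linarith
  \<comment> \<open>Differentiating exp(-s t) \<open>exp_erfc c t\<close> gives -(s - c^2) times the
    integrand, minus c exp(-s t) / sqrt(pi t). The \<open>erfc\<close> term has exactly the latter
    as its derivative and removes it.\<close>
  let ?F = "\<lambda>t. (c / sqrt s * erfc (sqrt s * sqrt t) - exp (- s * t) * exp_erfc c t) / (s - c\<^sup>2)"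
  have "((\<lambda>t. exp (- s * t) * exp_erfc c t) has_integral (?F T - ?F 0)) {0..T}" if "T \<ge> 0" for T
  proof (rule has_integral_FTC_real[OF that])
    show "continuous_on {0..T} ?F"
      using c s \<open>s > 0\<close>
      by (intro continuous_intros continuous_on_subset[OF continuous_on_exp_erfc]
          continuous_on_subset[OF continuous_on_erfc_sqrt]) auto
    fix x assume x: "0 < x" "x < T"
    let ?e = "exp (- s * x)"
    have "(?F has_real_derivative (c / sqrt s * (- (sqrt s / (sqrt pi * sqrt x) * exp (- ((sqrt s)\<^sup>2 * x))))
        - ((?e * (- s)) * exp_erfc c x + (c\<^sup>2 * exp_erfc c x - c / (sqrt pi * sqrt x)) * ?e)) / (s - c\<^sup>2)) (at x)"
      by (intro DERIV_cdivide DERIV_diff DERIV_cmult DERIV_mult erfc_sqrt_has_real_derivative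
          exp_erfc_has_real_derivative) (use x c s \<open>s > 0\<close> in \<open>auto intro!: derivative_eq_intros\<close>)
    also have "(c / sqrt s * (- (sqrt s / (sqrt pi * sqrt x) * exp (- ((sqrt s)\<^sup>2 * x))))
        - ((?e * (- s)) * exp_erfc c x + (c\<^sup>2 * exp_erfc c x - c / (sqrt pi * sqrt x)) * ?e)) / (s - c\<^sup>2)
        = ?e * exp_erfc c x"
      using s \<open>s > 0\<close> by (simp add: algebra_simps divide_simps)
    finally show "(?F has_real_derivative ?e * exp_erfc c x) (at x)" .
  qed
  then have eq: "integral {0..T} (\<lambda>t. exp (- s * t) * exp_erfc c t) = ?F T - ?F 0" if "T \<ge> 0" for T
    using that by (simp add: integral_unique)
  have lim_sqrt: "((\<lambda>t. erfc (a * sqrt t)) \<longlongrightarrow> 0) at_top" if "a > 0" for a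
    by (rule filterlim_compose[OF erfc_tendsto_0]) (use that in real_asymp)
  \<comment> \<open>Because \<open>s\<close> exceeds c^2, the boundary term at infinity is a product
    of a decaying exponential and \<open>erfc (c * sqrt t)\<close>, both tending to 0.\<close>
  have exp_split: "exp (- (s - c\<^sup>2) * t) = exp (- s * t) * exp (c\<^sup>2 * t)" for t
    by (simp add: mult_exp_exp left_diff_distrib)
  have "((\<lambda>t. exp (- (s - c\<^sup>2) * t)) \<longlongrightarrow> 0) at_top"
    using s by real_asymp
  then have "((\<lambda>t. exp (- (s - c\<^sup>2) * t) * erfc (c * sqrt t)) \<longlongrightarrow> 0 * 0) at_top"
    by (intro tendsto_intros lim_sqrt c)
  then have "((\<lambda>t. exp (- s * t) * exp_erfc c t) \<longlongrightarrow> 0) at_top"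
    by (simp only: exp_erfc_def exp_split mult.assoc mult_zero_left)
  then have "((\<lambda>T. ?F T - ?F 0) \<longlongrightarrow> (c / sqrt s * 0 - 0) / (s - c\<^sup>2) - ?F 0) at_top"
    using s \<open>s > 0\<close> by (intro tendsto_intros lim_sqrt) auto
  also have "(c / sqrt s * 0 - 0) / (s - c\<^sup>2) - ?F 0 = 1 / (sqrt s * (sqrt s + c))"
  \<comment> \<open>Only \<open>- ?F 0\<close> remains; cancelling the factor sqrt s - c of s - c^2
    gives the stated value.\<close>
  proof -
    have r: "sqrt s > c" "sqrt s > 0"
      using s c \<open>s > 0\<close> by (simp_all add: real_less_rsqrt)
    have "(sqrt s)\<^sup>2 - c\<^sup>2 = (sqrt s - c) * (sqrt s + c)"
      by (simp only: power2_eq_square square_diff_square_factored mult.commute)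
    then have "s - c\<^sup>2 = (sqrt s - c) * (sqrt s + c)"
      using \<open>s > 0\<close> by simp
    moreover have "c / sqrt s - 1 = - ((sqrt s - c) / sqrt s)"
      using r by (simp add: diff_divide_distrib)
    ultimately have "- ((c / sqrt s - 1) / (s - c\<^sup>2)) = 1 / (sqrt s * (sqrt s + c))"
      using r by simp
    then show ?thesis
      by (simp add: exp_erfc_0 erfc_0)
  qed
  finally show ?thesis
    by (rule Lim_transform_eventually[OF _ eventually_mono[OF eventually_ge_at_top[of 0]]])
      (simp only: eq)
qed

section \<open>Identification of the intensity and its integration\<close>

theorem mainTheorem5:
  fixes \<Lambda>\<^sub>0 \<alpha> \<gamma> :: real and lam :: "real \<Rightarrow> real"
  assumes "\<Lambda>\<^sub>0 > 0" and "0 < \<alpha>" and "\<alpha> < 1" and "\<gamma> > 0"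
    and "hawkes_expected_intensity \<Lambda>\<^sub>0 \<alpha> \<gamma> lam"
  shows "\<forall>t\<ge>0. expected_events lam t =
    \<Lambda>\<^sub>0 / (1 - \<alpha>) * t
    - \<alpha> * \<Lambda>\<^sub>0 / ((1 - \<alpha>) ^ 3 * \<gamma>\<^sup>2 * sqrt pi) *
      (sqrt pi * exp ((1 - \<alpha>)\<^sup>2 * \<gamma>\<^sup>2 * t) * erfc ((1 - \<alpha>) * \<gamma> * sqrt t)
       + 2 * (1 - \<alpha>) * \<gamma> * sqrt t - sqrt pi)"
proof (intro allI impI)
  fix t :: real assume t: "t \<ge> 0"
  define c where "c = (1 - \<alpha>) * \<gamma>"
  have c: "c > 0"
    using assms by (simp add: c_def)
  define A where "A = \<Lambda>\<^sub>0 / (1 - \<alpha>)"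
  \<comment> \<open>Found by partial fractions: with r = sqrt s, the prescribed transform is A / r^2
    - A \<alpha> / (r (r + c)), whose terms are the transforms of a constant and of a multiple of
    \<open>exp_erfc c\<close>.\<close>
  define lam\<^sub>0 where "lam\<^sub>0 x = A - A * \<alpha> * exp_erfc c x" for x
  have cont_lam: "continuous_on {0..} lam"
    and "\<forall>\<^sub>F s in at_top. has_laplace lam (hawkes_laplace \<Lambda>\<^sub>0 \<alpha> \<gamma> s) s"
    using assms by (auto simp: hawkes_expected_intensity_def)
  then obtain S where S: "\<And>s. s \<ge> S \<Longrightarrow> has_laplace lam (hawkes_laplace \<Lambda>\<^sub>0 \<alpha> \<gamma> s) s"
    by (auto simp: eventually_at_top_linorder)
  have cont_lam\<^sub>0: "continuous_on {0..} lam\<^sub>0"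
    unfolding lam\<^sub>0_def using c by (intro continuous_intros continuous_on_exp_erfc) auto
  have lim: "((\<lambda>T. integral {0..T} (\<lambda>t. exp (- s * t) * (lam t - lam\<^sub>0 t))) \<longlongrightarrow> 0) at_top"
    if "s \<ge> S" "s > c\<^sup>2" for s
  proof -
    have "s > 0"
      using \<open>s > c\<^sup>2\<close> zero_le_power2[of c] by linarith
    let ?L = "\<lambda>f T. integral {0..T} (\<lambda>t. exp (- s * t) * f t)"
    have "((\<lambda>T. ?L lam T - (A * ((1 - exp (- s * T)) / s) - A * \<alpha> * ?L (exp_erfc c) T)) \<longlongrightarrow>
        hawkes_laplace \<Lambda>\<^sub>0 \<alpha> \<gamma> s - (A * ((1 - 0) / s) - A * \<alpha> * (1 / (sqrt s * (sqrt s + c))))) at_top"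
    proof (intro tendsto_intros exp_erfc_laplace c that)
      show "(?L lam \<longlongrightarrow> hawkes_laplace \<Lambda>\<^sub>0 \<alpha> \<gamma> s) at_top"
        using S[OF \<open>s \<ge> S\<close>] unfolding has_laplace_def by (rule has_integral_atLeast_imp_tendsto)
      show "((\<lambda>T. exp (- s * T)) \<longlongrightarrow> 0) at_top"
        using \<open>s > 0\<close> by real_asymp
    qed (use \<open>s > 0\<close> in auto)
    also have "hawkes_laplace \<Lambda>\<^sub>0 \<alpha> \<gamma> s - (A * ((1 - 0) / s) - A * \<alpha> * (1 / (sqrt s * (sqrt s + c)))) = 0"
    proof -
      define r where "r = sqrt s"
      have r: "r > 0" "s = r * r"
        using \<open>s > 0\<close> by (auto simp: r_def)
      have "s powr (1 / 2) = r"
        using \<open>s > 0\<close> by (simp add: r_def powr_half_sqrt)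
      moreover have "\<Lambda>\<^sub>0 / (r * r) * ((\<gamma> + r) / (c + r)) = A * (1 / (r * r)) - A * \<alpha> * (1 / (r * (r + c)))"
      proof -
        have "A * (1 / (r * r)) - A * \<alpha> * (1 / (r * d)) = A * (d - \<alpha> * r) / (r * r * d)" if "d > 0" for d
          using r that by (simp add: field_simps)
        then have "A * (1 / (r * r)) - A * \<alpha> * (1 / (r * (r + c))) = A * ((r + c) - \<alpha> * r) / (r * r * (r + c))"
          using r c by simp
        \<comment> \<open>Here c = (1 - \<alpha>) \<gamma> lets the factor 1 - \<alpha> be pulled
          out, which then cancels the denominator of \<open>A\<close>.\<close>
        also have "A * ((r + c) - \<alpha> * r) = A * (1 - \<alpha>) * (\<gamma> + r)"
          by (simp add: c_def algebra_simps)
        also have "A * (1 - \<alpha>) = \<Lambda>\<^sub>0"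
          using assms by (simp add: A_def)
        finally show ?thesis
          using r c by (simp add: add.commute)
      qed
      ultimately show ?thesis
        unfolding hawkes_laplace_def c_def[symmetric] r_def[symmetric] by (simp add: r(2))
    qed
    finally show ?thesis
    proof (rule Lim_transform_eventually)
      have "?L (\<lambda>t. lam t - lam\<^sub>0 t) T = ?L lam T - (A * ((1 - exp (- s * T)) / s) - A * \<alpha> * ?L (exp_erfc c) T)"
        if "T \<ge> 0" for T
      proof -
        have "((\<lambda>t. exp (- s * t)) has_integral (- exp (- s * T) / s - (- exp (- s * 0) / s))) {0..T}"
          by (rule has_integral_FTC_real[OF that])
            (use \<open>s > 0\<close> in \<open>auto intro!: continuous_intros derivative_eq_intros\<close>)
        then have 1: "((\<lambda>t. exp (- s * t)) has_integral ((1 - exp (- s * T)) / s)) {0..T}"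
          by (simp add: diff_divide_distrib)
        have 2: "((\<lambda>t. exp (- s * t) * exp_erfc c t) has_integral ?L (exp_erfc c) T) {0..T}"
          using c by (intro integrable_integral integrable_continuous_real continuous_intros
              continuous_on_subset[OF continuous_on_exp_erfc]) auto
        have 3: "((\<lambda>t. exp (- s * t) * lam t) has_integral ?L lam T) {0..T}"
          by (intro integrable_integral integrable_continuous_real continuous_intros
              continuous_on_subset[OF cont_lam]) auto
        have "((\<lambda>t. exp (- s * t) * lam t - (A * exp (- s * t) - A * \<alpha> * (exp (- s * t) * exp_erfc c t)))
            has_integral (?L lam T - (A * ((1 - exp (- s * T)) / s) - A * \<alpha> * ?L (exp_erfc c) T))) {0..T}"
          by (intro has_integral_diff has_integral_mult_right 1 2 3)
        then show ?thesis
          by (intro integral_unique) (simp add: lam\<^sub>0_def algebra_simps)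
      qed
      then show "\<forall>\<^sub>F T in at_top. ?L lam T - (A * ((1 - exp (- s * T)) / s) - A * \<alpha> * ?L (exp_erfc c) T) =
          ?L (\<lambda>t. lam t - lam\<^sub>0 t) T"
        unfolding eventually_at_top_linorder by (intro exI[of _ 0]) auto
    qed
  qed
  have lam_eq: "lam x = lam\<^sub>0 x" if "x \<ge> 0" for x
  proof -
    have "lam x - lam\<^sub>0 x = 0"
    \<comment> \<open>This base point satisfies both thresholds of \<open>lim\<close>, and so does
      its shift by any natural number.\<close>
    proof (rule Lerch_zero[where s = "max S (c\<^sup>2 + 1)" and g = "\<lambda>x. lam x - lam\<^sub>0 x"])
      show "continuous_on {0..} (\<lambda>x. lam x - lam\<^sub>0 x)"
        by (intro continuous_intros cont_lam cont_lam\<^sub>0)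
      show "x \<ge> 0"
        by (fact that)
    qed (rule lim; auto)
    then show ?thesis by simp
  qed
  have "(lam\<^sub>0 has_integral (A * t - A * \<alpha> * ((exp_erfc c t - 1) / c\<^sup>2 + 2 * sqrt t / (c * sqrt pi)))) {0..t}"
    unfolding lam\<^sub>0_def
    using has_integral_const_real[of A 0 t] t
    by (intro has_integral_diff has_integral_mult_right exp_erfc_has_integral c) (auto simp: mult.commute)
  then have "expected_events lam t = A * t - A * \<alpha> * ((exp_erfc c t - 1) / c\<^sup>2 + 2 * sqrt t / (c * sqrt pi))"
    unfolding expected_events_def
    by (subst integral_cong[of _ _ lam\<^sub>0]) (auto simp: lam_eq integral_unique)
  also have "A * \<alpha> * ((exp_erfc c t - 1) / c\<^sup>2 + 2 * sqrt t / (c * sqrt pi)) =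
      \<alpha> * \<Lambda>\<^sub>0 / ((1 - \<alpha>) ^ 3 * \<gamma>\<^sup>2 * sqrt pi) *
      (sqrt pi * exp_erfc c t + 2 * c * sqrt t - sqrt pi)"
  \<comment> \<open>The common denominator is c^2 sqrt pi; the factor 1 - \<alpha> in the
    denominator of \<open>A\<close> raises the square of 1 - \<alpha> in c^2 to the cube.\<close>
  proof -
    have "(x - 1) / c\<^sup>2 + 2 * y / (c * p) = (p * x + 2 * c * y - p) / (c\<^sup>2 * p)"
      if "p > 0" for p x y :: real
      using that c by (simp add: field_simps power2_eq_square)
    from this[of "sqrt pi"]
    have "A * \<alpha> * ((exp_erfc c t - 1) / c\<^sup>2 + 2 * sqrt t / (c * sqrt pi)) =
        \<alpha> * \<Lambda>\<^sub>0 / ((1 - \<alpha>) * (c\<^sup>2 * sqrt pi)) *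
        (sqrt pi * exp_erfc c t + 2 * c * sqrt t - sqrt pi)"
      by (simp only: pi_gt_zero real_sqrt_gt_0_iff A_def times_divide_eq_left times_divide_eq_right
          divide_divide_eq_left mult_ac)
    also have "(1 - \<alpha>) * (c\<^sup>2 * sqrt pi) = (1 - \<alpha>) ^ 3 * \<gamma>\<^sup>2 * sqrt pi"
      by (simp only: c_def power_mult_distrib power2_eq_square power3_eq_cube mult_ac)
    finally show ?thesis .
  qed
  finally show "expected_events lam t = \<Lambda>\<^sub>0 / (1 - \<alpha>) * t
    - \<alpha> * \<Lambda>\<^sub>0 / ((1 - \<alpha>) ^ 3 * \<gamma>\<^sup>2 * sqrt pi) *
      (sqrt pi * exp ((1 - \<alpha>)\<^sup>2 * \<gamma>\<^sup>2 * t) * erfc ((1 - \<alpha>) * \<gamma> * sqrt t)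
       + 2 * (1 - \<alpha>) * \<gamma> * sqrt t - sqrt pi)"
    by (simp add: A_def c_def exp_erfc_def power_mult_distrib mult.assoc)
qed

end
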